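(* Let $d\ge4$ be an even integer and fix an integer $m$ with $1\le m\le d/2$. Then there is $N$ such that for all $n\ge N$, a random graph $G$ drawn from $\mathcal{G}_{n,d}$ satisfies $\lambda_2(G)\ge 2m$ with probability at least $n^{1-m}-\tfrac12 n^{2-2m}$.
   Context: $\mathcal{G}_{n,d}$: choose $d/2$ independent uniformly random permutations $\pi_1,\dots,\pi_{d/2}$ of $\{1,\dots,n\}$; $G$ is the $d$-regular multigraph on $\{1,\dots,n\}$ with adjacency matrix $A=\sum_{j=1}^{d/2}(P_{\pi_j}+P_{\pi_j}^{-1})$, $P_\pi$ the permutation matrix of $\pi$ (fixed points give self-loops contributing $2$ to the diagonal). Its eigenvalues are $\lambda_1(G)=d\ge\lambda_2(G)\ge\cdots\ge\lambda_n(G)$. *)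

theory Defs
  imports
    "HOL-Probability.Probability"
    "HOL-Probability.Product_PMF"
    "HOL-Combinatorics.Permutations"
    "Jordan_Normal_Form.Char_Poly"
begin

text \<open>
  Vertices are \<open>1, \<dots>, n\<close>; matrices are indexed from 0, so row and column
  \<open>i\<close> belong to vertex \<open>Suc i\<close>.
\<close>

definition perm_matrix :: "nat \<Rightarrow> (nat \<Rightarrow> nat) \<Rightarrow> real mat" where
  "perm_matrix n \<pi> = Matrix.mat n n (\<lambda>(i, j). if \<pi> (Suc j) = Suc i then 1 else 0)"

text \<open>The matrix of the inverse permutation is the inverse matrix.\<close>

lemma perm_matrix_inv:
  assumes "\<pi> permutes {1..n}"
  shows "perm_matrix n \<pi> * perm_matrix n (inv_into UNIV \<pi>) = 1\<^sub>m n"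
proof (rule eq_matI)
  fix i j assume "i < dim_row (1\<^sub>m n :: real mat)" "j < dim_col (1\<^sub>m n :: real mat)"
  then have ij: "i < n" "j < n" by simp_all
  have "inv_into UNIV \<pi> (Suc j) \<in> {1..n}"
    using permutes_in_image[OF permutes_inv[OF assms], of "Suc j"] ij by simp
  then obtain k0 where k0: "inv_into UNIV \<pi> (Suc j) = Suc k0" "k0 < n"
    by (cases "inv_into UNIV \<pi> (Suc j)") auto
  have "\<pi> (Suc k0) = Suc j"
    using k0(1) permutes_inverses(1)[OF assms, of "Suc j"] by simp
  have "(perm_matrix n \<pi> * perm_matrix n (inv_into UNIV \<pi>)) $$ (i, j) =
      (\<Sum>k\<in>{0..<n}. (if \<pi> (Suc k) = Suc i then 1 else 0) *
                     (if inv_into UNIV \<pi> (Suc j) = Suc k then 1 else 0))"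
    using ij by (simp add: perm_matrix_def times_mat_def scalar_prod_def)
  also have "\<dots> = (\<Sum>k\<in>{0..<n}. if k = k0 then (if \<pi> (Suc k) = Suc i then 1 else 0) else 0)"
    by (rule sum.cong) (auto simp: k0)
  also have "\<dots> = (1\<^sub>m n :: real mat) $$ (i, j)"
    using ij k0(2) \<open>\<pi> (Suc k0) = Suc j\<close> by simp
  finally show "(perm_matrix n \<pi> * perm_matrix n (inv_into UNIV \<pi>)) $$ (i, j) = 1\<^sub>m n $$ (i, j)" .
qed (simp_all add: perm_matrix_def)

definition adjacency_matrix :: "nat \<Rightarrow> nat \<Rightarrow> (nat \<Rightarrow> nat \<Rightarrow> nat) \<Rightarrow> real mat" where
  "adjacency_matrix n k \<pi> = Matrix.mat n n (\<lambda>(i, j).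
     \<Sum>l\<in>{1..k}. perm_matrix n (\<pi> l) $$ (i, j) + perm_matrix n (inv_into UNIV (\<pi> l)) $$ (i, j))"

text \<open>
  A multigraph on \<open>{1..n}\<close> is identified with its adjacency matrix, a self-loop
  contributing 2 to the diagonal.
\<close>

definition random_multigraph :: "nat \<Rightarrow> nat \<Rightarrow> real mat pmf" where
  "random_multigraph n d =
     map_pmf (adjacency_matrix n (d div 2))
       (Pi_pmf {1..d div 2} id (\<lambda>_. pmf_of_set {\<pi>. \<pi> permutes {1..n}}))"

text \<open>
  The \<open>k\<close>-th largest eigenvalue (\<open>k \<ge> 1\<close>), counted with multiplicity. For a real
  symmetric \<open>n \<times> n\<close> matrix the list of
  eigenvalues has length \<open>n\<close>, so the value is meaningful for \<open>1 \<le> k \<le> n\<close>.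
\<close>

definition eigenvalues_desc :: "real mat \<Rightarrow> real list" where
  "eigenvalues_desc A = rev (sorted_list_of_multiset (proots (char_poly A)))"

definition eigenvalue_nth :: "nat \<Rightarrow> real mat \<Rightarrow> real" where
  "eigenvalue_nth k A = eigenvalues_desc A ! (k - 1)"

end

theory Submission
  imports Defs "Jordan_Normal_Form.Schur_Decomposition"
begin

text \<open>
  If the first \<open>m\<close> permutations all preserve a set \<open>S\<close> of one or two vertices, then the indicator
  of \<open>S\<close> has Rayleigh quotient at least \<open>2m\<close>. The indicator of the vertices outside \<open>S\<close> and not
  adjacent to it is orthogonal to it, also with respect to the adjacency form, and for large \<open>n\<close>
  has Rayleigh quotient at least \<open>2m\<close> as well, so \<open>\<lambda>\<^sub>2 \<ge> 2m\<close>.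

  For \<open>m = 1\<close> Bonferroni's inequality over the fixed points suffices. For \<open>m \<ge> 2\<close>, fixed points alone
  give \<open>n^(1-m) - (n(n-1))^(1-m)/2\<close>, which is slightly too small. The events that the first permutation
  swaps a pair of vertices while the next \<open>m - 1\<close> fix both are each as likely as two given common fixed
  points, so including them cancels the error term exactly, leaving one of smaller order.
\<close>

no_notation inner (infix "\<bullet>" 70)
no_notation vec_nth (infixl "$" 90)

section \<open>Spectral theorem for real symmetric matrices\<close>

text \<open>Over the complex numbers the characteristic polynomial has a root \<open>z\<close>.
  Moving the real symmetric matrix across the Hermitian product of an eigenvector with itself gives
  \<open>z = cnj z\<close>, so the root is real.\<close>

lemma symmetric_mat_has_eigenvalue:
  fixes A :: "real mat"
  assumes A: "A \<in> carrier_mat n n" and sym: "A\<^sup>T = A" and n: "n > 0"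
  shows "\<exists>e. eigenvalue A e"
proof -
  let ?C = "map_mat complex_of_real A"
  have C: "?C \<in> carrier_mat n n" using A by simp
  have "degree (char_poly ?C) = n" using degree_monic_char_poly[OF C] by simp
  hence "\<not> constant (poly (char_poly ?C))"
    using n by (simp add: constant_degree)
  then obtain z where z: "poly (char_poly ?C) z = 0"
    using fundamental_theorem_of_algebra by blast
  hence "eigenvalue ?C z" using eigenvalue_root_char_poly[OF C] by simp
  then obtain v where v: "v \<in> carrier_vec n" "v \<noteq> 0\<^sub>v n" "?C *\<^sub>v v = z \<cdot>\<^sub>v v"
    using C by (auto simp: eigenvalue_def eigenvector_def)
  have cv: "conjugate v \<in> carrier_vec n" using v(1) by simp
  have "?C\<^sup>T = ?C" using sym by (metis map_mat_transpose)
  have conjC: "?C *\<^sub>v conjugate v = conjugate (?C *\<^sub>v v)"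
    using v(1) A by (intro eq_vecI) (auto simp: scalar_prod_def sum_conjugate)
  have "z * (v \<bullet>c v) = (?C *\<^sub>v v) \<bullet>c v"
    using v by simp
  also have "\<dots> = v \<bullet> (?C *\<^sub>v conjugate v)"
    using transpose_vec_mult_scalar[OF C v(1) cv] \<open>?C\<^sup>T = ?C\<close> v(1) cv C
    by (metis comm_scalar_prod mult_mat_vec_carrier)
  also have "\<dots> = cnj z * (v \<bullet>c v)"
    unfolding conjC v(3) conjugate_smult_vec using v(1) by simp
  finally have "z = cnj z" using v by simp
  then have "z = complex_of_real (Re z)" by (simp add: complex_eq_iff)
  then have "poly (map_poly complex_of_real (char_poly A)) (complex_of_real (Re z)) = 0"
    using z by (simp add: of_real_hom.char_poly_hom[OF A])
  then have "poly (char_poly A) (Re z) = 0" by simp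
  then show ?thesis using eigenvalue_root_char_poly[OF A] by blast
qed

text \<open>Gram-Schmidt applied to a basis starting with \<open>v\<close> leaves \<open>v\<close>
  in first place, and normalising makes the result orthonormal. The scalar \<open>c\<close> stays
  unspecified because only the direction of the first column matters later.\<close>

lemma orthonormal_basis_extending:
  fixes v :: "real vec"
  assumes v: "v \<in> carrier_vec n" "v \<noteq> 0\<^sub>v n"
  shows "\<exists>W c. W \<in> carrier_mat n n \<and> W\<^sup>T * W = 1\<^sub>m n \<and> col W 0 = c \<cdot>\<^sub>v v"
proof -
  interpret cof_vec_space n "TYPE(real)" .
  have n: "n > 0" using v by (cases n) auto
  define b where "b = basis_completion v"
  define ws where "ws = gram_schmidt n b"
  from basis_completion[OF v, folded b_def]
  have dist_b: "distinct b" and indep: "\<not> lin_dep (set b)" and b: "set b \<subseteq> carrier_vec n"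
    and hdb: "hd b = v" and len_b: "length b = n" by auto
  from hdb len_b n obtain vs where bv: "b = v # vs" by (cases b, auto)
  from gram_schmidt_result[OF b dist_b indep refl, folded ws_def]
  have ws: "set ws \<subseteq> carrier_vec n" "corthogonal ws" "length ws = n"
    by (auto simp: len_b)
  have hdws: "ws ! 0 = v"
    using gram_schmidt_hd[OF v(1), of vs, folded bv] n ws(3) hd_conv_nth[of ws]
    unfolding ws_def[symmetric] by fastforce
  define us where "us = map (\<lambda>w. (1 / sqrt (w \<bullet> w)) \<cdot>\<^sub>v w) ws"
  have wsc: "ws ! i \<in> carrier_vec n" if "i < n" for i using ws that by auto
  have us: "us ! i = (1 / sqrt (ws ! i \<bullet> ws ! i)) \<cdot>\<^sub>v (ws ! i)" if "i < n" for i
    using that ws(3) by (simp add: us_def)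
  have orth: "us ! i \<bullet> us ! j = (if i = j then 1 else 0)" if "i < n" "j < n" for i j
  proof -
    have *: "ws ! i \<bullet> ws ! j = 0 \<longleftrightarrow> i \<noteq> j"
      using corthogonalD[OF ws(2)] that ws(3) by simp
    moreover have "ws ! i \<bullet> ws ! i \<ge> 0"
      using conjugate_square_ge_0_vec[of "ws ! i"] by simp
    ultimately show ?thesis
      unfolding us[OF that(1)] us[OF that(2)] using wsc[OF that(1)] wsc[OF that(2)] by auto
  qed
  define W where "W = mat_of_cols n us"
  have lus: "length us = n" using ws by (simp add: us_def)
  have W: "W \<in> carrier_mat n n" by (auto simp: W_def lus)
  have usc: "us ! i \<in> carrier_vec n" if "i < n" for i using us wsc that by simp
  have colW: "col W i = us ! i" if "i < n" for i
    unfolding W_def using that usc lus by (intro col_mat_of_cols) auto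
  have "W\<^sup>T * W = 1\<^sub>m n"
    using W by (intro eq_matI) (auto simp: colW orth)
  moreover have "col W 0 = (1 / sqrt (v \<bullet> v)) \<cdot>\<^sub>v v"
    using colW[OF n] us[OF n] hdws by simp
  ultimately show ?thesis using W by blast
qed

text \<open>With an eigenvector as first column of the orthogonal matrix \<open>W\<close>, the first
  column of the conjugated matrix is a multiple of the first unit vector. Symmetry carries this over
  to the first row.\<close>

lemma symmetric_mat_deflation:
  fixes A :: "real mat"
  assumes A: "A \<in> carrier_mat (Suc n) (Suc n)" and sym: "A\<^sup>T = A"
  shows "\<exists>W e A'. W \<in> carrier_mat (Suc n) (Suc n) \<and> W\<^sup>T * W = 1\<^sub>m (Suc n) \<and>
    A' \<in> carrier_mat n n \<and> A'\<^sup>T = A' \<and>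
    W\<^sup>T * A * W = four_block_mat (mat 1 1 (\<lambda>_. e)) (0\<^sub>m 1 n) (0\<^sub>m n 1) A'"
proof -
  obtain e v where v: "v \<in> carrier_vec (Suc n)" "v \<noteq> 0\<^sub>v (Suc n)" "A *\<^sub>v v = e \<cdot>\<^sub>v v"
    using symmetric_mat_has_eigenvalue[OF A sym] A by (auto simp: eigenvalue_def eigenvector_def)
  obtain W c where W: "W \<in> carrier_mat (Suc n) (Suc n)" "W\<^sup>T * W = 1\<^sub>m (Suc n)"
      "col W 0 = c \<cdot>\<^sub>v v"
    using orthonormal_basis_extending[OF v(1,2)] by blast
  define M where "M = W\<^sup>T * A * W"
  have M: "M \<in> carrier_mat (Suc n) (Suc n)" using W A by (simp add: M_def)
  have Msym: "M\<^sup>T = M"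
    using W A sym by (simp add: M_def transpose_mult[of _ "Suc n" "Suc n" _ "Suc n"]
        assoc_mult_mat[of _ "Suc n" "Suc n" _ "Suc n" _ "Suc n"])
  have AW: "col (A * W) 0 = e \<cdot>\<^sub>v col W 0"
  proof -
    have "col (A * W) 0 = A *\<^sub>v col W 0" using A W(1) by auto
    also have "\<dots> = c \<cdot>\<^sub>v (A *\<^sub>v v)" unfolding W(3) using A v by (metis mult_mat_vec)
    also have "\<dots> = e \<cdot>\<^sub>v col W 0" unfolding v(3) W(3) by (simp add: smult_smult_assoc mult.commute)
    finally show ?thesis .
  qed
  have M0: "M $$ (i, 0) = (if i = 0 then e else 0)" if "i < Suc n" for i
  proof -
    have "M $$ (i, 0) = (W\<^sup>T * (A * W)) $$ (i, 0)" 
      using W A by (simp add: M_def assoc_mult_mat[of _ "Suc n" "Suc n" _ "Suc n" _ "Suc n"])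
    also have "\<dots> = col W i \<bullet> (e \<cdot>\<^sub>v col W 0)"
      using W A that AW by simp
    also have "\<dots> = e * (W\<^sup>T * W) $$ (i, 0)" using W(1) that by simp
    finally show ?thesis using that by (simp add: W(2))
  qed
  have M0': "M $$ (0, i) = (if i = 0 then e else 0)" if "i < Suc n" for i
    using M0[OF that] that M Msym by (metis carrier_matD index_transpose_mat(1) zero_less_Suc)
  define A' where "A' = mat n n (\<lambda>(i, j). M $$ (Suc i, Suc j))"
  have "M $$ (Suc i, Suc j) = M $$ (Suc j, Suc i)" if "i < n" "j < n" for i j
    using that M Msym by (metis Suc_mono carrier_matD index_transpose_mat(1))
  then have "A'\<^sup>T = A'" by (intro eq_matI) (auto simp: A'_def)
  moreover have "M = four_block_mat (mat 1 1 (\<lambda>_. e)) (0\<^sub>m 1 n) (0\<^sub>m n 1) A'" (is "_ = ?F")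
  proof (rule eq_matI)
    fix i j assume "i < dim_row ?F" "j < dim_col ?F"
    then have "i < Suc n" "j < Suc n" by (simp_all add: A'_def)
    then show "M $$ (i, j) = ?F $$ (i, j)"
      by (cases i; cases j) (simp_all add: A'_def M0 M0')
  qed (use M in \<open>simp_all add: A'_def\<close>)
  moreover have "A' \<in> carrier_mat n n" by (simp add: A'_def)
  ultimately show ?thesis
    using W(1,2) unfolding M_def by (intro exI[of _ W] exI[of _ e] exI[of _ A'] conjI)
qed

text \<open>Induction on the dimension: if \<open>P\<close> diagonalises the deflated block, then
  \<open>W\<close> times the block matrix of 1 and \<open>P\<close> diagonalises
  \<open>A\<close>.\<close>

lemma symmetric_mat_diagonalizable:
  fixes A :: "real mat"
  assumes "A \<in> carrier_mat n n" and "A\<^sup>T = A"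
  shows "\<exists>P B. P \<in> carrier_mat n n \<and> B \<in> carrier_mat n n \<and> P\<^sup>T * P = 1\<^sub>m n \<and>
    diagonal_mat B \<and> P\<^sup>T * A * P = B"
  using assms
proof (induction n arbitrary: A)
  case 0
  then show ?case
    by (intro exI[of _ "1\<^sub>m 0"] exI[of _ A]) (auto simp: diagonal_mat_def)
next
  case (Suc n)
  note A = Suc.prems(1)
  obtain W e A' where W: "W \<in> carrier_mat (Suc n) (Suc n)" "W\<^sup>T * W = 1\<^sub>m (Suc n)"
    and A': "A' \<in> carrier_mat n n" "A'\<^sup>T = A'"
    and WAW: "W\<^sup>T * A * W = four_block_mat (mat 1 1 (\<lambda>_. e)) (0\<^sub>m 1 n) (0\<^sub>m n 1) A'"
    using symmetric_mat_deflation[OF Suc.prems] by blast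
  obtain P B where P: "P \<in> carrier_mat n n" "P\<^sup>T * P = 1\<^sub>m n"
    and B: "B \<in> carrier_mat n n" "diagonal_mat B" "P\<^sup>T * A' * P = B"
    using Suc.IH[OF A'] by blast
  define Q where "Q = four_block_mat (1\<^sub>m 1) (0\<^sub>m 1 n) (0\<^sub>m n 1) P"
  define D where "D = four_block_mat (mat 1 1 (\<lambda>_. e)) (0\<^sub>m 1 n) (0\<^sub>m n 1) B"
  have Q: "Q \<in> carrier_mat (Suc n) (Suc n)" using P by (auto simp: Q_def)
  have QT: "Q\<^sup>T = four_block_mat (1\<^sub>m 1) (0\<^sub>m 1 n) (0\<^sub>m n 1) P\<^sup>T"
    using P by (simp add: Q_def transpose_four_block_mat[of _ 1 1 _ n _ n])
  have QQ: "Q\<^sup>T * Q = 1\<^sub>m (Suc n)"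
    unfolding QT unfolding Q_def using P
    using four_block_one_mat[of 1 n]
    by (simp add: mult_four_block_mat[of _ 1 1 _ n _ n _ _ 1 _ n])
  have QAQ: "Q\<^sup>T * (W\<^sup>T * A * W) * Q = D"
    unfolding QT WAW unfolding Q_def D_def using P A' B
    by (simp add: mult_four_block_mat[of _ 1 1 _ n _ n _ _ 1 _ n])
  have "(W * Q)\<^sup>T * (W * Q) = Q\<^sup>T * (W\<^sup>T * W) * Q"
    using W(1) Q by (simp add: transpose_mult[of _ "Suc n" "Suc n" _ "Suc n"]
        assoc_mult_mat[of _ "Suc n" "Suc n" _ "Suc n" _ "Suc n"])
  then have orth: "(W * Q)\<^sup>T * (W * Q) = 1\<^sub>m (Suc n)"
    using Q QQ by (simp add: W(2))
  have "(W * Q)\<^sup>T * A * (W * Q) = Q\<^sup>T * (W\<^sup>T * A * W) * Q"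
    using W(1) Q A by (simp add: transpose_mult[of _ "Suc n" "Suc n" _ "Suc n"]
        assoc_mult_mat[of _ "Suc n" "Suc n" _ "Suc n" _ "Suc n"])
  then have "(W * Q)\<^sup>T * A * (W * Q) = D" using QAQ by simp
  moreover have "D \<in> carrier_mat (Suc n) (Suc n)"
    using four_block_carrier_mat[of "mat 1 1 (\<lambda>_. e)" 1 1 B n n] B(1) by (simp add: D_def)
  moreover have "diagonal_mat D" 
    using B by (auto simp: D_def diagonal_mat_def)
  ultimately show ?case using orth W(1) Q by (intro exI[of _ "W * Q"] exI[of _ D]) simp
qed

section \<open>A lower bound for the second eigenvalue\<close>

lemma diagonal_quadratic_form:
  fixes y :: "real vec"
  assumes "B \<in> carrier_mat n n" "diagonal_mat B" "y \<in> carrier_vec n"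
  shows "y \<bullet> (B *\<^sub>v y) = (\<Sum>i<n. B $$ (i, i) * (y $ i)\<^sup>2)"
proof -
  have "(B *\<^sub>v y) $ i = B $$ (i, i) * y $ i" if "i < n" for i
  proof -
    have "(B *\<^sub>v y) $ i = (\<Sum>j<n. B $$ (i, j) * y $ j)"
      using assms that by (simp add: scalar_prod_def atLeast0LessThan)
    also have "\<dots> = (\<Sum>j<n. if j = i then B $$ (i, i) * y $ i else 0)"
      using assms that by (intro sum.cong) (auto simp: diagonal_mat_def)
    finally show ?thesis using that by simp
  qed
  then show ?thesis
    using assms by (simp add: scalar_prod_def atLeast0LessThan power2_eq_square mult_ac)
qed

text \<open>The two-dimensional case of the Courant-Fischer argument. By the orthogonality relations
  the form is at least \<open>c\<close> times the squared norm on the whole span of \<open>u\<close>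
  and \<open>v\<close>. This span contains a nonzero vector without \<open>k\<close>-th coordinate
  in the eigenbasis, so the remaining diagonal entries cannot all lie below
  \<open>c\<close>.\<close>

lemma diagonal_ge_of_orthogonal_pair:
  fixes A :: "real mat"
  assumes A: "A \<in> carrier_mat n n" and sym: "A\<^sup>T = A"
    and P: "P \<in> carrier_mat n n" "P\<^sup>T * P = 1\<^sub>m n"
    and B: "B \<in> carrier_mat n n" "diagonal_mat B" "P\<^sup>T * A * P = B"
    and uv: "u \<in> carrier_vec n" "v \<in> carrier_vec n" "u \<noteq> 0\<^sub>v n" "v \<noteq> 0\<^sub>v n"
    and orth: "u \<bullet> v = 0" "u \<bullet> (A *\<^sub>v v) = 0"
    and ge: "u \<bullet> (A *\<^sub>v u) \<ge> c * (u \<bullet> u)" "v \<bullet> (A *\<^sub>v v) \<ge> c * (v \<bullet> v)"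
    and k: "k < n"
  shows "\<exists>j<n. j \<noteq> k \<and> B $$ (j, j) \<ge> c"
proof (rule ccontr)
  assume "\<not> ?thesis"
  then have less: "B $$ (j, j) < c" if "j < n" "j \<noteq> k" for j
    using that by force
  have PT: "P\<^sup>T \<in> carrier_mat n n" using P by simp
  have PPT: "P * P\<^sup>T = 1\<^sub>m n" using mat_mult_left_right_inverse[OF PT P(1,2)] .
  define a where "a = (P\<^sup>T *\<^sub>v u) $ k"
  define b where "b = (P\<^sup>T *\<^sub>v v) $ k"
  \<comment> \<open>Some nonzero combination of \<open>u\<close> and \<open>v\<close> is orthogonal to the \<open>k\<close>-th eigenvector.\<close>
  obtain \<alpha> \<beta> where ab: "\<alpha> * a + \<beta> * b = 0" "\<alpha> \<noteq> 0 \<or> \<beta> \<noteq> 0"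
  proof (cases "a = 0")
    case True then show ?thesis using that[of 1 0] by simp
  next
    case False then show ?thesis using that[of "-b" a] by simp
  qed
  define x where "x = \<alpha> \<cdot>\<^sub>v u + \<beta> \<cdot>\<^sub>v v"
  define y where "y = P\<^sup>T *\<^sub>v x"
  have x: "x \<in> carrier_vec n" using uv by (simp add: x_def)
  have y: "y \<in> carrier_vec n" using PT x by (simp add: y_def)
  have "P *\<^sub>v y = (P * P\<^sup>T) *\<^sub>v x"
    unfolding y_def using assoc_mult_mat_vec[OF P(1) PT x] by simp
  then have Py: "P *\<^sub>v y = x" using x by (simp add: PPT)
  have yk: "y $ k = 0"
    using ab k uv P unfolding y_def x_def a_def b_def
    by (simp add: scalar_prod_add_distrib[of _ n])
  \<comment> \<open>Used with \<open>N = A\<close>, \<open>M = B\<close> and with both equal to the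
    identity: the change of basis preserves the form and the norm.\<close>
  have form: "y \<bullet> (M *\<^sub>v y) = x \<bullet> (N *\<^sub>v x)"
    if N: "N \<in> carrier_mat n n" and M: "P\<^sup>T * N * P = M" for M N
  proof -
    have "M *\<^sub>v y = P\<^sup>T *\<^sub>v (N *\<^sub>v x)"
      unfolding M[symmetric] using P(1) PT N x y Py
      by (simp add: assoc_mult_mat_vec[of _ n n _ n] assoc_mult_mat[of _ n n _ n _ n])
    then have "y \<bullet> (M *\<^sub>v y) = y \<bullet> (P\<^sup>T *\<^sub>v (N *\<^sub>v x))" by simp
    also have "\<dots> = (P *\<^sub>v y) \<bullet> (N *\<^sub>v x)"
      using transpose_vec_mult_scalar[OF P(1) y, of "N *\<^sub>v x"] N x P y
        comm_scalar_prod[OF y, of "P\<^sup>T *\<^sub>v (N *\<^sub>v x)"]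
        comm_scalar_prod[of "P *\<^sub>v y" n "N *\<^sub>v x"] by simp
    finally show ?thesis by (simp add: Py)
  qed
  have lin: "x \<bullet> (N *\<^sub>v x) = \<alpha>\<^sup>2 * (u \<bullet> (N *\<^sub>v u)) + \<alpha> * \<beta> * (u \<bullet> (N *\<^sub>v v))
      + \<alpha> * \<beta> * (v \<bullet> (N *\<^sub>v u)) + \<beta>\<^sup>2 * (v \<bullet> (N *\<^sub>v v))"
    if N: "N \<in> carrier_mat n n" for N
    using N uv unfolding x_def
    by (simp add: mult_add_distrib_mat_vec[of _ n n] mult_mat_vec[of _ n n]
        add_scalar_prod_distrib[of _ n] scalar_prod_add_distrib[of _ n] algebra_simps power2_eq_square)
  have vAu: "v \<bullet> (A *\<^sub>v u) = 0"
    using transpose_vec_mult_scalar[OF A uv(2,1)] sym orth(2) uv A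
    by (metis comm_scalar_prod mult_mat_vec_carrier)
  have vu: "v \<bullet> u = 0" using orth(1) uv by (simp add: comm_scalar_prod[of v n])
  have xx: "x \<bullet> x = \<alpha>\<^sup>2 * (u \<bullet> u) + \<beta>\<^sup>2 * (v \<bullet> v)"
    using lin[of "1\<^sub>m n"] uv x orth vu by simp
  have xAx: "x \<bullet> (A *\<^sub>v x) = \<alpha>\<^sup>2 * (u \<bullet> (A *\<^sub>v u)) + \<beta>\<^sup>2 * (v \<bullet> (A *\<^sub>v v))"
    using lin[OF A] orth vAu by simp
  have "\<alpha>\<^sup>2 * (c * (u \<bullet> u)) + \<beta>\<^sup>2 * (c * (v \<bullet> v)) \<le> x \<bullet> (A *\<^sub>v x)"
    unfolding xAx by (intro add_mono mult_left_mono ge) auto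
  then have ge': "c * (x \<bullet> x) \<le> x \<bullet> (A *\<^sub>v x)" unfolding xx by (simp add: algebra_simps)
  have pos: "w \<bullet> w > 0" if "w \<in> carrier_vec n" "w \<noteq> 0\<^sub>v n" for w :: "real vec"
    using conjugate_square_greater_0_vec[OF that(1)] that(2) by simp
  have "x \<bullet> x > 0"
    unfolding xx using ab(2) pos[OF uv(1,3)] pos[OF uv(2,4)]
    by (cases "\<alpha> = 0") (auto intro!: add_pos_nonneg)
  moreover have yy: "y \<bullet> y = x \<bullet> x"
    using form[of "1\<^sub>m n" "1\<^sub>m n"] P PT x y by simp
  ultimately have "y \<noteq> 0\<^sub>v n" using y by auto
  then obtain i where i: "i < n" "y $ i \<noteq> 0" using y by (metis eq_vecI carrier_vecD index_zero_vec)
  have "y \<bullet> (B *\<^sub>v y) - c * (y \<bullet> y) = (\<Sum>i<n. (B $$ (i, i) - c) * (y $ i)\<^sup>2)"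
    using y unfolding diagonal_quadratic_form[OF B(1,2) y]
    by (simp add: scalar_prod_def atLeast0LessThan sum_distrib_left sum_subtractf
        left_diff_distrib power2_eq_square)
  \<comment> \<open>The index \<open>k\<close> contributes nothing since \<open>y $ k = 0\<close>,
    all other coefficients are negative, and some other coordinate of \<open>y\<close> is
    nonzero.\<close>
  also have "\<dots> < (\<Sum>i<n. 0)"
  proof (rule sum_strict_mono_ex1)
    show "\<forall>i\<in>{..<n}. (B $$ (i, i) - c) * (y $ i)\<^sup>2 \<le> 0"
      using less yk by (force intro: mult_nonpos_nonneg)
    show "\<exists>i\<in>{..<n}. (B $$ (i, i) - c) * (y $ i)\<^sup>2 < 0"
      using less[of i] i yk by (intro bexI[of _ i] mult_neg_pos) auto
  qed simp
  finally show False using ge' form[OF A B(3)] yy by simp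
qed

section \<open>From diagonal entries to the ordered list of eigenvalues\<close>

text \<open>\<open>A\<close> is similar to \<open>B\<close>, and a diagonal matrix is upper
  triangular, so the characteristic polynomial splits into linear factors whose roots are the
  diagonal entries with multiplicity.\<close>

lemma eigenvalues_desc_diagonal:
  fixes A :: "real mat"
  assumes A: "A \<in> carrier_mat n n"
    and P: "P \<in> carrier_mat n n" "P\<^sup>T * P = 1\<^sub>m n"
    and B: "B \<in> carrier_mat n n" "diagonal_mat B" "P\<^sup>T * A * P = B"
  shows "eigenvalues_desc A = rev (sort (diag_mat B))"
proof -
  have PT: "P\<^sup>T \<in> carrier_mat n n" using P by simp
  have PPT: "P * P\<^sup>T = 1\<^sub>m n" using mat_mult_left_right_inverse[OF PT P(1,2)] .
  have "similar_mat_wit B A P\<^sup>T P"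
    using A P PT B PPT by (intro similar_mat_witI[of _ _ n]) auto
  then have "char_poly A = char_poly B"
    using char_poly_similar similar_mat_def by metis
  also have "\<dots> = (\<Prod>a\<leftarrow>diag_mat B. [:- a, 1:])"
    using B(1,2)
    by (intro char_poly_upper_triangular[OF B(1)] upper_triangularI) (auto simp: diagonal_mat_def)
  finally have cp: "char_poly A = (\<Prod>a\<leftarrow>diag_mat B. [:- a, 1:])" .
  have "proots (\<Prod>a\<leftarrow>xs. [:- a, 1:]) = mset xs" for xs :: "real list"
  proof (induction xs)
    case (Cons a xs)
    have "(\<Prod>a\<leftarrow>xs. [:- a, 1:]) \<noteq> 0" by (auto simp: prod_list_zero_iff)
    then show ?case using Cons proots_mult[of "[:- a, 1:]" "\<Prod>a\<leftarrow>xs. [:- a, 1:]"] by simp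
  qed simp
  then show ?thesis by (simp add: eigenvalues_desc_def cp)
qed

text \<open>Sorting preserves the number of entries that are at least \<open>c\<close>, here two or
  more. If the entry at position 1 of the descending list were below \<open>c\<close>, only position
  0 could hold such an entry.\<close>

lemma second_largest_ge:
  fixes xs :: "real list"
  assumes "i < length xs" "j < length xs" "i \<noteq> j" "xs ! i \<ge> c" "xs ! j \<ge> c"
  shows "rev (sort xs) ! 1 \<ge> c"
proof (rule ccontr)
  define ys where "ys = rev (sort xs)"
  assume "\<not> ?thesis"
  then have less: "ys ! 1 < c" by (simp add: ys_def)
  have len: "length ys = length xs" by (simp add: ys_def)
  have desc: "ys ! l \<le> ys ! 1" if "1 \<le> l" "l < length ys" for l
  proof -
    have "sorted (rev ys)" by (simp add: ys_def)
    then show ?thesis using that sorted_rev_nth_mono by blast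
  qed
  have "card {i, j} \<le> card {l. l < length xs \<and> xs ! l \<ge> c}"
    using assms by (intro card_mono) auto
  also have "\<dots> = length (filter (\<lambda>x. x \<ge> c) xs)" by (simp add: length_filter_conv_card)
  also have "\<dots> = size (filter_mset (\<lambda>x. x \<ge> c) (mset ys))" by (simp add: ys_def flip: mset_filter)
  also have "\<dots> = card {l. l < length ys \<and> ys ! l \<ge> c}"
    by (simp add: length_filter_conv_card flip: mset_filter)
  also have "\<dots> \<le> card {0::nat}"
  proof (rule card_mono)
    show "{l. l < length ys \<and> c \<le> ys ! l} \<subseteq> {0}"
    proof
      fix l assume "l \<in> {l. l < length ys \<and> c \<le> ys ! l}"
      then show "l \<in> {0}" using desc[of l] less by (cases "l = 0") auto
    qed
  qed simp
  finally show False using assms(3) by simp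
qed

lemma eigenvalue_nth_2_ge:
  fixes A :: "real mat"
  assumes A: "A \<in> carrier_mat n n" and sym: "A\<^sup>T = A"
    and uv: "u \<in> carrier_vec n" "v \<in> carrier_vec n" "u \<noteq> 0\<^sub>v n" "v \<noteq> 0\<^sub>v n"
    and orth: "u \<bullet> v = 0" "u \<bullet> (A *\<^sub>v v) = 0"
    and ge: "u \<bullet> (A *\<^sub>v u) \<ge> c * (u \<bullet> u)" "v \<bullet> (A *\<^sub>v v) \<ge> c * (v \<bullet> v)"
  shows "eigenvalue_nth 2 A \<ge> c"
proof -
  obtain P B where P: "P \<in> carrier_mat n n" "P\<^sup>T * P = 1\<^sub>m n"
    and B: "B \<in> carrier_mat n n" "diagonal_mat B" "P\<^sup>T * A * P = B"
    using symmetric_mat_diagonalizable[OF A sym] by blast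
  note ex = diagonal_ge_of_orthogonal_pair[OF A sym P B uv orth ge]
  have "n > 0" using uv by (cases n) auto
  \<comment> \<open>Excluding some index gives \<open>i\<close>; excluding \<open>i\<close> itself
    then gives a second position.\<close>
  then obtain i where i: "i < n" "B $$ (i, i) \<ge> c" using ex by blast
  then obtain j where j: "j < n" "j \<noteq> i" "B $$ (j, j) \<ge> c" using ex by blast
  have "rev (sort (diag_mat B)) ! 1 \<ge> c"
    using i j B by (intro second_largest_ge[of i _ j]) (auto simp: diag_mat_def)
  then show ?thesis
    by (simp add: eigenvalue_nth_def eigenvalues_desc_diagonal[OF A P B])
qed

section \<open>Nearly invariant sets of vertices\<close>

definition indicator_vec :: "nat \<Rightarrow> nat set \<Rightarrow> real vec" where
  "indicator_vec n S = vec n (\<lambda>i. of_bool (Suc i \<in> S))"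

lemma indicator_vec_carrier [simp]: "indicator_vec n S \<in> carrier_vec n"
  by (simp add: indicator_vec_def)

text \<open>Passes from matrix indices, which start at 0, to vertices, which start at 1.\<close>

lemma sum_indicator_shift:
  fixes f :: "nat \<Rightarrow> real"
  assumes "S \<subseteq> {1..n}"
  shows "(\<Sum>i<n. of_bool (Suc i \<in> S) * f (Suc i)) = sum f S"
proof -
  have "(\<Sum>i<n. of_bool (Suc i \<in> S) * f (Suc i)) = (\<Sum>a\<in>{1..n}. of_bool (a \<in> S) * f a)"
    by (simp add: sum.atLeast1_atMost_eq)
  also have "\<dots> = sum f S"
    using assms by (intro sum.mono_neutral_cong_right) auto
  finally show ?thesis .
qed

lemma indicator_vec_scalar_prod:
  assumes "S \<subseteq> {1..n}"
  shows "indicator_vec n S \<bullet> indicator_vec n T = card (S \<inter> T)"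
proof -
  have "indicator_vec n S \<bullet> indicator_vec n T =
      (\<Sum>i<n. of_bool (Suc i \<in> S) * of_bool (Suc i \<in> T))"
    by (simp add: scalar_prod_def indicator_vec_def atLeast0LessThan)
  also have "\<dots> = (\<Sum>a\<in>S. of_bool (a \<in> T))" by (rule sum_indicator_shift[OF assms])
  also have "\<dots> = card (S \<inter> T)"
    using finite_subset[OF assms] by (simp add: sum_of_bool_eq Int_def)
  finally show ?thesis .
qed

lemma adjacency_matrix_carrier [simp]: "adjacency_matrix n k \<pi> \<in> carrier_mat n n"
  by (simp add: adjacency_matrix_def)

text \<open>The inverse permutation maps \<open>Suc j\<close> to \<open>Suc i\<close> exactly when
  the permutation maps \<open>Suc i\<close> to \<open>Suc j\<close>. Without inverses the symmetry
  in \<open>i\<close> and \<open>j\<close> is evident.\<close>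

lemma adjacency_matrix_entry:
  assumes "\<And>l. l \<in> {1..k} \<Longrightarrow> \<pi> l permutes {1..n}" and "i < n" "j < n"
  shows "adjacency_matrix n k \<pi> $$ (i, j) =
    (\<Sum>l\<in>{1..k}. of_bool (\<pi> l (Suc j) = Suc i) + of_bool (\<pi> l (Suc i) = Suc j))"
proof -
  have "inv_into UNIV (\<pi> l) (Suc j) = Suc i \<longleftrightarrow> \<pi> l (Suc i) = Suc j" if "l \<in> {1..k}" for l
    using permutes_inverses[OF assms(1)[OF that]] by metis
  then show ?thesis
    unfolding adjacency_matrix_def index_mat(1)[OF assms(2,3)] prod.case
    using assms(2,3) by (intro sum.cong refl) (simp add: perm_matrix_def of_bool_def)
qed

lemma adjacency_matrix_symmetric:
  assumes "\<And>l. l \<in> {1..k} \<Longrightarrow> \<pi> l permutes {1..n}"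
  shows "(adjacency_matrix n k \<pi>)\<^sup>T = adjacency_matrix n k \<pi>"
proof (rule eq_matI)
  fix i j
  assume "i < dim_row (adjacency_matrix n k \<pi>)" "j < dim_col (adjacency_matrix n k \<pi>)"
  then have ij: "i < n" "j < n" by (simp_all add: adjacency_matrix_def)
  moreover have "adjacency_matrix n k \<pi> $$ (j, i) = adjacency_matrix n k \<pi> $$ (i, j)"
    using adjacency_matrix_entry[of k \<pi> n i j] adjacency_matrix_entry[of k \<pi> n j i] ij assms
    by (simp add: add.commute)
  ultimately show "(adjacency_matrix n k \<pi>)\<^sup>T $$ (i, j) = adjacency_matrix n k \<pi> $$ (i, j)"
    by (simp add: adjacency_matrix_def)
qed (simp_all add: adjacency_matrix_def)

text \<open>After exchanging the sums so that \<open>l\<close> is outermost, each inner sum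
  collapses because a vertex has exactly one image. What remains counts the passages between
  \<open>S\<close> and \<open>W\<close> in both directions.\<close>

lemma adjacency_matrix_form:
  assumes perm: "\<And>l. l \<in> {1..k} \<Longrightarrow> \<pi> l permutes {1..n}"
    and S: "S \<subseteq> {1..n}" and W: "W \<subseteq> {1..n}"
  shows "indicator_vec n S \<bullet> (adjacency_matrix n k \<pi> *\<^sub>v indicator_vec n W) =
    (\<Sum>l\<in>{1..k}. real (card {b\<in>W. \<pi> l b \<in> S}) + real (card {a\<in>S. \<pi> l a \<in> W}))"
proof -
  let ?A = "adjacency_matrix n k \<pi>"
  define f where "f a b = (\<Sum>l\<in>{1..k}. of_bool (\<pi> l b = a) + of_bool (\<pi> l a = b) :: real)" for a b
  have fin: "finite S" "finite W" using S W by (auto intro: finite_subset)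
  have dim: "dim_row ?A = n" "dim_col ?A = n" by (simp_all add: adjacency_matrix_def)
  have row: "(?A *\<^sub>v indicator_vec n W) $ i = sum (f (Suc i)) W" if "i < n" for i
  proof -
    have "(?A *\<^sub>v indicator_vec n W) $ i = (\<Sum>j<n. ?A $$ (i, j) * of_bool (Suc j \<in> W))"
      using that dim
      by (simp add: scalar_prod_def indicator_vec_def atLeast0LessThan del: sum_mult_of_bool_eq sum_of_bool_mult_eq)
    also have "\<dots> = (\<Sum>j<n. of_bool (Suc j \<in> W) * f (Suc i) (Suc j))"
    proof (rule sum.cong[OF refl])
      fix j assume "j \<in> {..<n}"
      then have "?A $$ (i, j) = f (Suc i) (Suc j)"
        unfolding f_def using that by (intro adjacency_matrix_entry perm) auto
      then show "?A $$ (i, j) * of_bool (Suc j \<in> W) = of_bool (Suc j \<in> W) * f (Suc i) (Suc j)"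
        by simp
    qed
    finally show ?thesis by (simp add: sum_indicator_shift[OF W])
  qed
  have "indicator_vec n S \<bullet> (?A *\<^sub>v indicator_vec n W) =
      (\<Sum>i<n. of_bool (Suc i \<in> S) * sum (f (Suc i)) W)"
  proof -
    have "indicator_vec n S \<bullet> (?A *\<^sub>v indicator_vec n W) =
        (\<Sum>i<n. indicator_vec n S $ i * (?A *\<^sub>v indicator_vec n W) $ i)"
      using dim by (simp add: scalar_prod_def atLeast0LessThan)
    also have "\<dots> = (\<Sum>i<n. of_bool (Suc i \<in> S) * sum (f (Suc i)) W)"
      by (intro sum.cong refl) (simp only: lessThan_iff row, simp add: indicator_vec_def)
    finally show ?thesis .
  qed
  also have "\<dots> = (\<Sum>a\<in>S. \<Sum>b\<in>W. f a b)" by (rule sum_indicator_shift[OF S])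
  also have "\<dots> = (\<Sum>l\<in>{1..k}. \<Sum>a\<in>S. \<Sum>b\<in>W. of_bool (\<pi> l b = a) + of_bool (\<pi> l a = b))"
    unfolding f_def by (rule trans[OF sum.cong[OF refl sum.swap] sum.swap])
  also have "\<dots> = (\<Sum>l\<in>{1..k}. real (card {b\<in>W. \<pi> l b \<in> S}) + real (card {a\<in>S. \<pi> l a \<in> W}))"
  proof (rule sum.cong[OF refl])
    fix l assume "l \<in> {1..k}"
    have "(\<Sum>a\<in>S. \<Sum>b\<in>W. of_bool (\<pi> l b = a) :: real) = (\<Sum>b\<in>W. \<Sum>a\<in>S. of_bool (\<pi> l b = a))"
      by (rule sum.swap)
    also have "\<dots> = (\<Sum>b\<in>W. of_bool (\<pi> l b \<in> S))"
      using fin by (intro sum.cong refl) (auto simp: of_bool_def)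
    finally have 1: "(\<Sum>a\<in>S. \<Sum>b\<in>W. of_bool (\<pi> l b = a) :: real) = card {b\<in>W. \<pi> l b \<in> S}"
      using fin by (simp add: sum_of_bool_eq Int_def)
    have "(\<Sum>a\<in>S. \<Sum>b\<in>W. of_bool (\<pi> l a = b) :: real) = (\<Sum>a\<in>S. of_bool (\<pi> l a \<in> W))"
      using fin by (intro sum.cong refl) (auto simp: of_bool_def)
    then have 2: "(\<Sum>a\<in>S. \<Sum>b\<in>W. of_bool (\<pi> l a = b) :: real) = card {a\<in>S. \<pi> l a \<in> W}"
      using fin by (simp add: sum_of_bool_eq Int_def)
    show "(\<Sum>a\<in>S. \<Sum>b\<in>W. of_bool (\<pi> l b = a) + of_bool (\<pi> l a = b)) =
        real (card {b\<in>W. \<pi> l b \<in> S}) + real (card {a\<in>S. \<pi> l a \<in> W})"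
      by (simp add: sum.distrib 1 2)
  qed
  finally show ?thesis .
qed

section \<open>Two test vectors from an invariant set\<close>

text \<open>The test vectors are the indicators of \<open>S\<close> and of the set \<open>W\<close>
  of vertices that are neither in \<open>S\<close> nor adjacent to it. No edge joins the two sets.
  Each permutation moves at most \<open>card U\<close> vertices out of \<open>W\<close>, which is
  negligible for large \<open>n\<close>.\<close>

lemma second_eigenvalue_ge_of_invariant_set:
  assumes perm: "\<And>l. l \<in> {1..k} \<Longrightarrow> \<pi> l permutes {1..n}"
    and m: "1 \<le> m" "m \<le> k"
    and S: "S \<subseteq> {1..n}" "S \<noteq> {}" "card S \<le> 2"
    and inv: "\<And>l. l \<in> {1..m} \<Longrightarrow> \<pi> l ` S \<subseteq> S"
    and n: "n \<ge> 8 * k + 2"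
  shows "eigenvalue_nth 2 (adjacency_matrix n k \<pi>) \<ge> 2 * real m"
proof -
  let ?A = "adjacency_matrix n k \<pi>"
  \<comment> \<open>The neighbours of \<open>S\<close> through the remaining \<open>k - m\<close>
    permutations. Each contributes at most two images and two preimages, hence the factor 4
    below.\<close>
  define U where "U = (\<Union>l\<in>{m+1..k}. \<pi> l ` S \<union> inv_into UNIV (\<pi> l) ` S)"
  define W where "W = {1..n} - (S \<union> U)"
  have finS: "finite S" using S finite_subset by blast
  have finU: "finite U" using finS by (auto simp: U_def)
  have finW: "finite W" by (simp add: W_def)
  have cU: "card U \<le> 4 * (k - m)"
  proof -
    have "card U \<le> (\<Sum>l\<in>{m+1..k}. card (\<pi> l ` S \<union> inv_into UNIV (\<pi> l) ` S))"
      unfolding U_def by (rule card_UN_le) simp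
    also have "\<dots> \<le> (\<Sum>l\<in>{m+1..k}. 4)"
    proof (rule sum_mono)
      fix l
      have "card (\<pi> l ` S \<union> inv_into UNIV (\<pi> l) ` S) \<le> card (\<pi> l ` S) + card (inv_into UNIV (\<pi> l) ` S)"
        by (rule card_Un_le)
      also have "\<dots> \<le> card S + card S" by (intro add_mono card_image_le finS)
      finally show "card (\<pi> l ` S \<union> inv_into UNIV (\<pi> l) ` S) \<le> 4" using S(3) by simp
    qed
    finally show ?thesis by simp
  qed
  \<comment> \<open>The hypothesis \<open>n \<ge> 8 * k + 2\<close> absorbs the at most
    \<open>2 + 4 * (k - m)\<close> deleted vertices.\<close>
  have cW: "card W \<ge> 4 * k"
  proof -
    have "card {1..n} - card (S \<union> U) \<le> card W"
      unfolding W_def using finS finU by (intro diff_card_le_card_Diff) simp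
    moreover have "card (S \<union> U) \<le> 2 + 4 * (k - m)"
      using card_Un_le[of S U] S(3) cU by simp
    ultimately show ?thesis using n m by simp
  qed
  have inj: "inj_on (\<pi> l) X" if "l \<in> {1..k}" for l X
    using permutes_inj[OF perm[OF that]] by (rule inj_on_subset) simp
  \<comment> \<open>An injective self-map of a finite set is onto, so the first \<open>m\<close>
    permutations cannot enter \<open>S\<close> from outside either.\<close>
  have inS: "\<pi> l ` S = S" if "l \<in> {1..m}" for l
    using endo_inj_surj[OF finS inv[OF that]] inj[of l S] that m by auto
  have WS: "\<pi> l x \<notin> S" if "l \<in> {1..k}" "x \<in> W" for l x
  proof
    assume *: "\<pi> l x \<in> S"
    show False
    proof (cases "l \<le> m")
      case True
      then have "\<pi> l x \<in> \<pi> l ` S" using inS[of l] * that(1) by simp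
      then obtain y where "y \<in> S" "\<pi> l x = \<pi> l y" by blast
      then have "x \<in> S" using permutes_inj[OF perm[OF that(1)]] by (metis injD)
      then show False using that by (simp add: W_def)
    next
      case False
      have "x = inv_into UNIV (\<pi> l) (\<pi> l x)" using permutes_inverses(2)[OF perm[OF that(1)]] by simp
      then have "x \<in> U" using * False that(1) unfolding U_def by fastforce
      then show False using that by (simp add: W_def)
    qed
  qed
  have SW: "\<pi> l x \<notin> W" if "l \<in> {1..k}" "x \<in> S" for l x
  proof (cases "l \<le> m")
    case True
    then show ?thesis using inS[of l] that by (auto simp: W_def)
  next
    case False
    then show ?thesis using that by (force simp: W_def U_def)
  qed
  \<comment> \<open>A vertex leaving \<open>W\<close> cannot land in \<open>S\<close>, so it lands
    in \<open>U\<close>; injectivity then bounds the number of such vertices.\<close>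
  have stay: "real (card W) - real (card U) \<le> card {x\<in>W. \<pi> l x \<in> W}" if l: "l \<in> {1..k}" for l
  proof -
    have "\<pi> l ` {x\<in>W. \<pi> l x \<notin> W} \<subseteq> U"
      using WS[OF l] permutes_in_image[OF perm[OF l]] by (auto simp: W_def)
    then have "card {x\<in>W. \<pi> l x \<notin> W} \<le> card U"
      using inj[OF l] finU by (intro card_inj_on_le)
    moreover have "card W = card {x\<in>W. \<pi> l x \<in> W} + card {x\<in>W. \<pi> l x \<notin> W}"
      using finW by (subst card_Un_disjoint[symmetric]) (auto intro: arg_cong[where f=card])
    ultimately show ?thesis by linarith
  qed
  have Wn: "W \<subseteq> {1..n}" by (auto simp: W_def)
  have SWd: "S \<inter> W = {}" by (auto simp: W_def)
  note form = adjacency_matrix_form[of k \<pi> n, OF perm]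
  let ?u = "indicator_vec n S" and ?w = "indicator_vec n W"
  have uu: "?u \<bullet> ?u = card S" using indicator_vec_scalar_prod[OF S(1), of S] by simp
  have ww: "?w \<bullet> ?w = card W" using indicator_vec_scalar_prod[OF Wn, of W] by simp
  have "card S > 0" using S(2) finS by (simp add: card_gt_0_iff)
  moreover have "card W > 0" using cW m by linarith
  ultimately have nz: "?u \<noteq> 0\<^sub>v n" "?w \<noteq> 0\<^sub>v n" using uu ww by auto
  have "real m * card S = (\<Sum>l\<in>{1..m}. real (card S))" by simp
  also have "\<dots> \<le> (\<Sum>l\<in>{1..k}. real (card {x\<in>S. \<pi> l x \<in> S}))"
  proof (rule order_trans[OF sum_mono sum_mono2])
    fix l assume "l \<in> {1..m}"
    then have "{x\<in>S. \<pi> l x \<in> S} = S" using inv by blast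
    then show "real (card S) \<le> card {x\<in>S. \<pi> l x \<in> S}" by simp
  qed (use m in auto)
  finally have geS: "?u \<bullet> (?A *\<^sub>v ?u) \<ge> 2 * real m * (?u \<bullet> ?u)"
    by (subst form[OF _ S(1) S(1)]) (simp_all add: uu sum.distrib flip: sum_distrib_left)
  \<comment> \<open>The bounds on both cardinalities give
    \<open>k * card U \<le> (k - m) * card W\<close>, which rearranges to
    \<open>m * card W \<le> k * (card W - card U)\<close>.\<close>
  have "real k * real (card U) \<le> real k * (4 * (real k - real m))"
    using of_nat_mono[OF cU, where ?'a = real] m by (intro mult_left_mono) (simp_all add: of_nat_diff)
  also have "\<dots> \<le> (real k - real m) * card W"
    using mult_left_mono[of "real (4 * k)" "real (card W)" "real k - real m"] cW m
    by (simp add: mult_ac)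
  finally have "real m * card W \<le> (\<Sum>l\<in>{1..k}. real (card W) - real (card U))"
    by (simp add: algebra_simps)
  also have "\<dots> \<le> (\<Sum>l\<in>{1..k}. real (card {x\<in>W. \<pi> l x \<in> W}))"
    by (intro sum_mono stay)
  finally have geW: "?w \<bullet> (?A *\<^sub>v ?w) \<ge> 2 * real m * (?w \<bullet> ?w)"
    by (subst form[OF _ Wn Wn]) (simp_all add: ww sum.distrib flip: sum_distrib_left)
  have crossing: "real (card {x\<in>W. \<pi> l x \<in> S}) + real (card {x\<in>S. \<pi> l x \<in> W}) = 0"
    if "l \<in> {1..k}" for l
  proof -
    have "{x\<in>W. \<pi> l x \<in> S} = {}" "{x\<in>S. \<pi> l x \<in> W} = {}"
      using WS[OF that] SW[OF that] by auto
    then show ?thesis by (simp only: card.empty)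
  qed
  have "?u \<bullet> (?A *\<^sub>v ?w) = 0"
    by (subst form[OF _ S(1) Wn], assumption, intro sum.neutral ballI crossing)
  then show ?thesis
    using nz geS geW SWd indicator_vec_scalar_prod[OF S(1), of W]
    by (intro eigenvalue_nth_2_ge[of ?A n ?u ?w] adjacency_matrix_symmetric perm) auto
qed

section \<open>Common cycles of random permutations\<close>

text \<open>Composition with the inverse of \<open>\<sigma>\<close> turns agreement with
  \<open>\<sigma>\<close> on \<open>X\<close> into fixing \<open>X\<close> pointwise, leaving the
  permutations of \<open>V - X\<close>.\<close>

lemma card_permutes_agreeing:
  assumes V: "finite V" and \<sigma>: "\<sigma> permutes V" and X: "X \<subseteq> V"
  shows "card {\<pi>. \<pi> permutes V \<and> (\<forall>x\<in>X. \<pi> x = \<sigma> x)} = fact (card V - card X)"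
proof -
  have "{\<pi>. \<pi> permutes V \<and> (\<forall>x\<in>X. \<pi> x = \<sigma> x)} = (\<lambda>\<rho>. \<sigma> \<circ> \<rho>) ` {\<rho>. \<rho> permutes V - X}"
  proof (intro equalityI subsetI)
    fix \<pi> assume "\<pi> \<in> {\<pi>. \<pi> permutes V \<and> (\<forall>x\<in>X. \<pi> x = \<sigma> x)}"
    then have \<pi>: "\<pi> permutes V" "\<And>x. x \<in> X \<Longrightarrow> \<pi> x = \<sigma> x" by auto
    have "inv_into UNIV \<sigma> \<circ> \<pi> permutes V" using permutes_compose[OF \<pi>(1) permutes_inv[OF \<sigma>]] .
    then have "inv_into UNIV \<sigma> \<circ> \<pi> permutes V - X"
      by (rule permutes_superset) (use \<pi>(2) permutes_inverses(2)[OF \<sigma>] in auto)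
    moreover have "\<pi> = \<sigma> \<circ> (inv_into UNIV \<sigma> \<circ> \<pi>)"
      using permutes_inverses(1)[OF \<sigma>] by (auto simp: fun_eq_iff)
    ultimately show "\<pi> \<in> (\<lambda>\<rho>. \<sigma> \<circ> \<rho>) ` {\<rho>. \<rho> permutes V - X}" by blast
  next
    fix \<pi> assume "\<pi> \<in> (\<lambda>\<rho>. \<sigma> \<circ> \<rho>) ` {\<rho>. \<rho> permutes V - X}"
    then obtain \<rho> where \<rho>: "\<rho> permutes V - X" "\<pi> = \<sigma> \<circ> \<rho>" by auto
    then show "\<pi> \<in> {\<pi>. \<pi> permutes V \<and> (\<forall>x\<in>X. \<pi> x = \<sigma> x)}"
      using permutes_compose[OF permutes_subset[OF \<rho>(1)] \<sigma>] permutes_not_in[OF \<rho>(1)] by auto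
  qed
  moreover have "inj_on (\<lambda>\<rho>. \<sigma> \<circ> \<rho>) {\<rho>. \<rho> permutes V - X}"
    using permutes_inj[OF \<sigma>] by (auto simp: inj_on_def fun.inj_map_strong inj_def fun_eq_iff)
  ultimately show ?thesis
    using V X by (simp add: card_image card_permutations card_Diff_subset finite_subset)
qed

lemma prob_permutation_agreeing:
  assumes "\<sigma> permutes {1..n}" and "X \<subseteq> {1..n}"
  shows "measure_pmf.prob (pmf_of_set {\<pi>. \<pi> permutes {1..n}}) {\<pi>. \<forall>x\<in>X. \<pi> x = \<sigma> x} =
    fact (n - card X) / fact n"
proof -
  have "{\<pi>. \<pi> permutes {1..n}} \<noteq> {}" using permutes_id by blast
  moreover have "{\<pi>. \<pi> permutes {1..n}} \<inter> {\<pi>. \<forall>x\<in>X. \<pi> x = \<sigma> x} =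
      {\<pi>. \<pi> permutes {1..n} \<and> (\<forall>x\<in>X. \<pi> x = \<sigma> x)}" by blast
  ultimately show ?thesis
    using card_permutes_agreeing[OF _ assms]
    by (simp add: measure_pmf_of_set finite_permutations card_permutations)
qed

text \<open>The law of the permutation tuple behind \<open>random_multigraph\<close>, kept apart
  because the events below depend on the permutations and not only on the matrix.\<close>

definition perm_family :: "nat \<Rightarrow> nat \<Rightarrow> (nat \<Rightarrow> nat \<Rightarrow> nat) pmf" where
  "perm_family n k = Pi_pmf {1..k} id (\<lambda>_. pmf_of_set {\<pi>. \<pi> permutes {1..n}})"

lemma prob_perm_family_agreeing:
  assumes \<sigma>: "\<And>l. l \<in> {1..m} \<Longrightarrow> \<sigma> l permutes {1..n}" and X: "X \<subseteq> {1..n}" and m: "m \<le> k"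
  shows "measure_pmf.prob (perm_family n k) {\<pi>. \<forall>l\<in>{1..m}. \<forall>x\<in>X. \<pi> l x = \<sigma> l x} =
    (fact (n - card X) / fact n) ^ m"
proof -
  \<comment> \<open>The event is a product event, unconstrained for indices beyond \<open>m\<close>;
    independence turns its probability into a product in which those factors are 1.\<close>
  let ?B = "\<lambda>l. if l \<le> m then {f. \<forall>x\<in>X. f x = \<sigma> l x} else UNIV"
  have "{\<pi>. \<forall>l\<in>{1..m}. \<forall>x\<in>X. \<pi> l x = \<sigma> l x} = Pi {1..k} ?B"
    using m by (auto simp: Pi_def)
  then have "measure_pmf.prob (perm_family n k) {\<pi>. \<forall>l\<in>{1..m}. \<forall>x\<in>X. \<pi> l x = \<sigma> l x} =
      (\<Prod>l\<in>{1..k}. measure_pmf.prob (pmf_of_set {\<pi>. \<pi> permutes {1..n}}) (?B l))"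
    by (simp only: perm_family_def measure_Pi_pmf_Pi finite_atLeastAtMost)
  also have "\<dots> = (\<Prod>l\<in>{1..m}. fact (n - card X) / fact n)"
    using m prob_permutation_agreeing[OF \<sigma> X] by (intro prod.mono_neutral_cong_right) auto
  finally show ?thesis by simp
qed

section \<open>Bonferroni's inequality\<close>

text \<open>Induction by inclusion-exclusion for the new event \<open>E x\<close> and the previous
  union, with the union bound for their intersection. The double sum runs over ordered pairs, hence
  the factor 1/2.\<close>

lemma bonferroni_lower_bound:
  assumes "finite I"
  shows "measure_pmf.prob p (\<Union>i\<in>I. E i) \<ge>
    (\<Sum>i\<in>I. measure_pmf.prob p (E i)) -
    1/2 * (\<Sum>i\<in>I. \<Sum>j\<in>I - {i}. measure_pmf.prob p (E i \<inter> E j))"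
  using assms
proof (induction I rule: finite_induct)
  case (insert x I)
  let ?P = "measure_pmf.prob p"
  let ?U = "\<Union>i\<in>I. E i"
  have "?P (E x \<inter> ?U) = ?P (\<Union>i\<in>I. E x \<inter> E i)" by (simp only: Int_UN_distrib)
  also have "\<dots> \<le> (\<Sum>i\<in>I. ?P (E x \<inter> E i))"
    using insert by (intro measure_pmf.finite_measure_subadditive_finite) auto
  finally have le: "?P (E x \<inter> ?U) \<le> (\<Sum>i\<in>I. ?P (E x \<inter> E i))" .
  have "?P (E x \<union> ?U) = ?P ?U + ?P (E x - ?U)"
    using measure_pmf.finite_measure_Union'[of ?U p "E x"] by (simp add: Un_commute)
  also have "?P (E x - ?U) = ?P (E x) - ?P (E x \<inter> ?U)"
    by (rule measure_pmf.finite_measure_Diff') auto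
  finally have union: "?P (E x \<union> ?U) = ?P ?U + ?P (E x) - ?P (E x \<inter> ?U)" by simp
  have "(\<Sum>i\<in>I. \<Sum>j\<in>insert x I - {i}. ?P (E i \<inter> E j)) =
      (\<Sum>i\<in>I. ?P (E x \<inter> E i) + (\<Sum>j\<in>I - {i}. ?P (E i \<inter> E j)))"
  proof (rule sum.cong[OF refl])
    fix i assume "i \<in> I"
    then have "insert x I - {i} = insert x (I - {i})" "x \<notin> I - {i}" using insert by auto
    then show "(\<Sum>j\<in>insert x I - {i}. ?P (E i \<inter> E j)) =
        ?P (E x \<inter> E i) + (\<Sum>j\<in>I - {i}. ?P (E i \<inter> E j))"
      using insert by (simp add: Int_commute)
  qed
  then have "(\<Sum>i\<in>insert x I. \<Sum>j\<in>insert x I - {i}. ?P (E i \<inter> E j)) =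
      2 * (\<Sum>i\<in>I. ?P (E x \<inter> E i)) + (\<Sum>i\<in>I. \<Sum>j\<in>I - {i}. ?P (E i \<inter> E j))"
    using insert by (simp add: sum.distrib)
  then show ?case using insert le union by (simp add: add_divide_distrib)
qed simp

section \<open>Swap events and their intersections\<close>

text \<open>On a singleton this is the identity, so common fixed points and swapped pairs are treated alike.\<close>

definition pair_swap :: "nat set \<Rightarrow> nat \<Rightarrow> nat" where
  "pair_swap P = Transposition.transpose (Min P) (Max P)"

text \<open>Removes \<open>Min\<close> and \<open>Max\<close> from later arguments: a transposition
  does not depend on the order of its two points.\<close>

lemma pair_swap_cases:
  assumes "card P \<in> {1, 2}"
  obtains a where "P = {a}" "pair_swap P = id"
  | a b where "P = {a, b}" "a \<noteq> b" "pair_swap P = Transposition.transpose a b"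
proof (cases "card P = 1")
  case True
  then obtain a where "P = {a}" using card_1_singletonE by blast
  then show ?thesis using that(1) by (simp add: pair_swap_def)
next
  case False
  then have "card P = 2" using assms by auto
  then obtain a b where P: "P = {a, b}" "a \<noteq> b" by (auto simp: card_2_iff)
  then have "pair_swap P = Transposition.transpose a b"
    by (cases "a < b") (auto simp: pair_swap_def min_def max_def transpose_commute)
  then show ?thesis using that(2) P by blast
qed

lemma pair_swap_permutes:
  assumes "card P \<in> {1, 2}"
  shows "pair_swap P permutes P"
  using assms by (rule pair_swap_cases) (auto simp: permutes_id permutes_swap_id)

text \<open>The swap acts transitively on \<open>P\<close>, so a nonempty invariant subset is
  everything.\<close>

lemma pair_swap_invariant_subset:
  assumes "card P \<in> {1, 2}" and "Q \<subseteq> P" "Q \<noteq> {}" and "pair_swap P ` Q \<subseteq> Q"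
  shows "Q = P"
  using assms(1)
proof (rule pair_swap_cases)
  fix a b assume *: "P = {a, b}" "a \<noteq> b" "pair_swap P = Transposition.transpose a b"
  obtain q where q: "q \<in> Q" using assms by auto
  then have "Transposition.transpose a b q \<in> Q" using assms(4) * by auto
  then show "Q = P" using q * assms(2) by (auto simp: Transposition.transpose_def split: if_splits)
qed (use assms in auto)

text \<open>Letting the first permutation swap a pair, instead of fixing both points, keeps the
  event of a pair disjoint from the events of its two points when \<open>m \<ge> 1\<close>.\<close>

definition swap_event :: "nat \<Rightarrow> nat set \<Rightarrow> (nat \<Rightarrow> nat \<Rightarrow> nat) set" where
  "swap_event m P = {\<pi>. \<forall>l\<in>{1..m}. \<forall>x\<in>P. \<pi> l x = (if l = 1 then pair_swap P else id) x}"

lemma prob_swap_event: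
  assumes "P \<subseteq> {1..n}" "card P \<in> {1, 2}" and "m \<le> k"
  shows "measure_pmf.prob (perm_family n k) (swap_event m P) = (fact (n - card P) / fact n) ^ m"
proof -
  let ?\<sigma> = "\<lambda>l::nat. if l = 1 then pair_swap P else id"
  have "?\<sigma> l permutes {1..n}" for l
    using permutes_subset[OF pair_swap_permutes[OF assms(2)] assms(1)] by (simp add: permutes_id)
  from prob_perm_family_agreeing[of m ?\<sigma> n P k, OF this assms(1,3)]
  show ?thesis unfolding swap_event_def .
qed

text \<open>Since the swaps have disjoint supports, their composition agrees with each of them on
  its own set. The two events together therefore prescribe values on
  \<open>P \<union> Q\<close>.\<close>

lemma prob_swap_event_inter:
  assumes P: "P \<subseteq> {1..n}" "card P \<in> {1, 2}" and Q: "Q \<subseteq> {1..n}" "card Q \<in> {1, 2}"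
    and disj: "P \<inter> Q = {}" and m: "m \<le> k"
  shows "measure_pmf.prob (perm_family n k) (swap_event m P \<inter> swap_event m Q) =
    (fact (n - (card P + card Q)) / fact n) ^ m"
proof -
  define \<sigma> where "\<sigma> l = (if l = 1 then pair_swap P \<circ> pair_swap Q else id)" for l :: nat
  note pp = pair_swap_permutes[OF P(2)] and pq = pair_swap_permutes[OF Q(2)]
  have "\<sigma> l permutes {1..n}" for l
    using permutes_compose[OF permutes_subset[OF pq Q(1)] permutes_subset[OF pp P(1)]]
    by (simp add: \<sigma>_def permutes_id)
  moreover have eq: "swap_event m P \<inter> swap_event m Q =
      {\<pi>. \<forall>l\<in>{1..m}. \<forall>x\<in>P \<union> Q. \<pi> l x = \<sigma> l x}"
  proof -
    have 1: "\<sigma> l x = (if l = 1 then pair_swap P else id) x" if "x \<in> P" for l x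
    proof -
      have "x \<notin> Q" using that disj by blast
      then show ?thesis using permutes_not_in[OF pq, of x] by (simp add: \<sigma>_def)
    qed
    have 2: "\<sigma> l x = (if l = 1 then pair_swap Q else id) x" if "x \<in> Q" for l x
    proof -
      have "pair_swap Q x \<in> Q" using that permutes_in_image[OF pq] by simp
      then have "pair_swap Q x \<notin> P" using disj by blast
      then have "pair_swap P (pair_swap Q x) = pair_swap Q x" by (rule permutes_not_in[OF pp])
      then show ?thesis by (simp add: \<sigma>_def)
    qed
    have "swap_event m P = {\<pi>. \<forall>l\<in>{1..m}. \<forall>x\<in>P. \<pi> l x = \<sigma> l x}"
      "swap_event m Q = {\<pi>. \<forall>l\<in>{1..m}. \<forall>x\<in>Q. \<pi> l x = \<sigma> l x}"
      unfolding swap_event_def by (simp_all only: 1 2 cong: ball_cong)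
    then show ?thesis by blast
  qed
  moreover have "card (P \<union> Q) = card P + card Q"
    using disj P Q finite_subset[of _ "{1..n}"] by (intro card_Un_disjoint) auto
  ultimately show ?thesis
    unfolding eq using prob_perm_family_agreeing[of m \<sigma> n "P \<union> Q" k] P Q m by simp
qed

text \<open>In both events at once, the first permutation agrees with both swaps on
  \<open>P \<inter> Q\<close>. This nonempty set is then invariant under each swap, so it equals
  both \<open>P\<close> and \<open>Q\<close>.\<close>

lemma swap_event_disjoint:
  assumes m: "1 \<le> m" and P: "card P \<in> {1, 2}" and Q: "card Q \<in> {1, 2}"
    and meet: "P \<inter> Q \<noteq> {}" and ne: "P \<noteq> Q"
  shows "swap_event m P \<inter> swap_event m Q = {}"
proof (rule ccontr)
  assume "\<not> ?thesis"
  then obtain \<pi> where \<pi>: "\<pi> \<in> swap_event m P" "\<pi> \<in> swap_event m Q" by blast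
  have 1: "\<pi> 1 x = pair_swap P x" if "x \<in> P" for x using \<pi>(1) m that by (auto simp: swap_event_def)
  have 2: "\<pi> 1 x = pair_swap Q x" if "x \<in> Q" for x using \<pi>(2) m that by (auto simp: swap_event_def)
  have inv: "\<pi> 1 x \<in> P \<inter> Q" if "x \<in> P \<inter> Q" for x
    using 1[of x] 2[of x] that permutes_in_image[OF pair_swap_permutes[OF P], of x]
      permutes_in_image[OF pair_swap_permutes[OF Q], of x] by auto
  have "P \<inter> Q = P" using inv 1 by (intro pair_swap_invariant_subset P meet) force+
  moreover have "P \<inter> Q = Q" using inv 2 by (intro pair_swap_invariant_subset Q meet) force+
  ultimately show False using ne by blast
qed

section \<open>Probability of the union of swap events\<close>

lemma sum_subsets_by_card:
  fixes f :: "nat \<Rightarrow> real"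
  assumes "finite V" and "finite K"
  shows "(\<Sum>P | P \<subseteq> V \<and> card P \<in> K. f (card P)) = (\<Sum>s\<in>K. real (card V choose s) * f s)"
proof -
  have "(\<Sum>P | P \<subseteq> V \<and> card P \<in> K. f (card P)) =
      (\<Sum>s\<in>K. \<Sum>P\<in>{P \<in> {P. P \<subseteq> V \<and> card P \<in> K}. card P = s}. f (card P))"
    using assms by (intro sum.group[symmetric]) auto
  also have "\<dots> = (\<Sum>s\<in>K. \<Sum>P | P \<subseteq> V \<and> card P = s. f s)"
    by (intro sum.cong) auto
  also have "\<dots> = (\<Sum>s\<in>K. real (card V choose s) * f s)"
    using n_subsets[OF assms(1)] by simp
  finally show ?thesis .
qed

text \<open>Here \<open>r s\<close> is the probability that one permutation takes prescribed values
  at \<open>s\<close> points. Choosing the points cancels one factor: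
  \<open>(n choose s) * r s = 1 / fact s\<close>, and similarly for two disjoint sets. Overlapping
  distinct sets contribute nothing to the Bonferroni sum, and \<open>n \<ge> 4\<close> leaves room
  for two disjoint pairs.\<close>

lemma prob_swap_event_union_ge:
  fixes n m k :: nat and K :: "nat set"
  defines "r \<equiv> \<lambda>s. fact (n - s) / fact n :: real"
  assumes K: "K \<subseteq> {1, 2}" and m: "1 \<le> m" "m \<le> k" and n: "n \<ge> 4"
  shows "measure_pmf.prob (perm_family n k) (\<Union>P\<in>{P. P \<subseteq> {1..n} \<and> card P \<in> K}. swap_event m P) \<ge>
    (\<Sum>s\<in>K. r s ^ (m - 1) / fact s) -
    1/2 * (\<Sum>s\<in>K. \<Sum>t\<in>K. r (s + t) ^ (m - 1) / (fact s * fact t))"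
proof -
  let ?V = "{1..n}"
  let ?I = "{P. P \<subseteq> ?V \<and> card P \<in> K}"
  let ?p = "\<lambda>A. measure_pmf.prob (perm_family n k) A"
  have finK: "finite K" using K finite_subset by blast
  have finI: "finite ?I" by simp
  \<comment> \<open>Splits off the factor that cancels against the binomial coefficients.\<close>
  have pm: "x ^ m = x * x ^ (m - 1)" for x :: real
    using m by (metis power_eq_if not_one_le_zero)
  have choose_r: "real (n choose s) * r s = 1 / fact s" if "s \<le> n" for s
    using that by (simp add: r_def binomial_fact)
  have choose_r2: "real (n choose s) * (real ((n - s) choose t) * r (s + t)) = 1 / (fact s * fact t)"
    if "s + t \<le> n" for s t
    using that by (simp add: r_def binomial_fact)
  have single: "(\<Sum>P\<in>?I. ?p (swap_event m P)) = (\<Sum>s\<in>K. r s ^ (m - 1) / fact s)"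
  proof -
    have "(\<Sum>P\<in>?I. ?p (swap_event m P)) = (\<Sum>P\<in>?I. r (card P) ^ m)"
      unfolding r_def using K m by (intro sum.cong refl prob_swap_event) auto
    also have "\<dots> = (\<Sum>s\<in>K. real (n choose s) * r s ^ m)"
      using sum_subsets_by_card[of ?V K "\<lambda>s. r s ^ m"] finK by simp
    also have "\<dots> = (\<Sum>s\<in>K. r s ^ (m - 1) / fact s)"
    proof (rule sum.cong[OF refl])
      fix s assume "s \<in> K"
      then have choose: "real (n choose s) * r s = 1 / fact s" using K n by (intro choose_r) auto
      have "real (n choose s) * r s ^ m = real (n choose s) * r s * r s ^ (m - 1)"
        unfolding pm by (simp only: mult.assoc)
      then show "real (n choose s) * r s ^ m = r s ^ (m - 1) / fact s"
        unfolding choose by simp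
    qed
    finally show ?thesis .
  qed
  have double: "(\<Sum>P\<in>?I. \<Sum>Q\<in>?I - {P}. ?p (swap_event m P \<inter> swap_event m Q)) =
      (\<Sum>s\<in>K. \<Sum>t\<in>K. r (s + t) ^ (m - 1) / (fact s * fact t))"
  proof -
    have "(\<Sum>Q\<in>?I - {P}. ?p (swap_event m P \<inter> swap_event m Q)) =
        (\<Sum>t\<in>K. real ((n - card P) choose t) * r (card P + t) ^ m)" if P: "P \<in> ?I" for P
    proof -
      have cP: "card P \<in> {1, 2}" using P K by auto
      then have P0: "P \<noteq> {}" by auto
      have "(\<Sum>Q\<in>?I - {P}. ?p (swap_event m P \<inter> swap_event m Q)) =
          (\<Sum>Q | Q \<subseteq> ?V - P \<and> card Q \<in> K. r (card P + card Q) ^ m)"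
      proof (rule sum.mono_neutral_cong_right)
        show "finite (?I - {P})" by simp
        show "{Q. Q \<subseteq> ?V - P \<and> card Q \<in> K} \<subseteq> ?I - {P}" using P0 by auto
        show "\<forall>Q\<in>?I - {P} - {Q. Q \<subseteq> ?V - P \<and> card Q \<in> K}.
            ?p (swap_event m P \<inter> swap_event m Q) = 0"
        proof
          fix Q assume Q: "Q \<in> ?I - {P} - {Q. Q \<subseteq> ?V - P \<and> card Q \<in> K}"
          then have "P \<inter> Q \<noteq> {}" "P \<noteq> Q" "card Q \<in> {1, 2}" using K by auto
          then show "?p (swap_event m P \<inter> swap_event m Q) = 0"
            using swap_event_disjoint[OF m(1) cP] by simp
        qed
        fix Q assume "Q \<in> {Q. Q \<subseteq> ?V - P \<and> card Q \<in> K}"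
        then have Q: "Q \<subseteq> ?V" "card Q \<in> {1, 2}" "P \<inter> Q = {}" using K by auto
        show "?p (swap_event m P \<inter> swap_event m Q) = r (card P + card Q) ^ m"
          unfolding r_def using prob_swap_event_inter[OF _ cP Q(1,2,3) m(2)] P by simp
      qed
      also have "\<dots> = (\<Sum>t\<in>K. real (card (?V - P) choose t) * r (card P + t) ^ m)"
        using sum_subsets_by_card[of "?V - P" K "\<lambda>t. r (card P + t) ^ m"] finK by simp
      also have "card (?V - P) = n - card P"
        using P by (subst card_Diff_subset) (auto intro: finite_subset)
      finally show ?thesis .
    qed
    then have "(\<Sum>P\<in>?I. \<Sum>Q\<in>?I - {P}. ?p (swap_event m P \<inter> swap_event m Q)) =
        (\<Sum>P\<in>?I. \<Sum>t\<in>K. real ((n - card P) choose t) * r (card P + t) ^ m)"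
      by (intro sum.cong) auto
    also have "\<dots> = (\<Sum>s\<in>K. real (n choose s) * (\<Sum>t\<in>K. real ((n - s) choose t) * r (s + t) ^ m))"
      using sum_subsets_by_card[of ?V K "\<lambda>s. \<Sum>t\<in>K. real ((n - s) choose t) * r (s + t) ^ m"] finK
      by simp
    also have "\<dots> = (\<Sum>s\<in>K. \<Sum>t\<in>K. r (s + t) ^ (m - 1) / (fact s * fact t))"
      unfolding sum_distrib_left
    proof (intro sum.cong refl)
      fix s t assume "s \<in> K" "t \<in> K"
      then have "s \<in> {1, 2}" "t \<in> {1, 2}" using K by auto
      then have "s + t \<le> n" using n by auto
      note choose = choose_r2[OF this]
      have "real (n choose s) * (real ((n - s) choose t) * r (s + t) ^ m) =
          real (n choose s) * (real ((n - s) choose t) * r (s + t)) * r (s + t) ^ (m - 1)"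
        unfolding pm by (simp only: mult.assoc)
      then show "real (n choose s) * (real ((n - s) choose t) * r (s + t) ^ m) =
          r (s + t) ^ (m - 1) / (fact s * fact t)"
        unfolding choose by simp
    qed
    finally show ?thesis .
  qed
  show ?thesis
    using bonferroni_lower_bound[OF finI, of "perm_family n k" "swap_event m"]
    unfolding single double .
qed

lemma fact_quotient_bounds:
  fixes n :: nat
  assumes n: "n \<ge> 5"
  shows "fact (n - 1) / fact n = 1 / real n"
    and "fact (n - 3) / fact n \<le> 1 / 2 * (1 / real n) ^ 2"
    and "fact (n - 4) / fact n \<le> 1 / 2 * (1 / real n) ^ 2"
proof -
  have f1: "fact n = real n * fact (n - 1)"
    using n by (intro fact_reduce) simp
  have f2: "fact (n - 1) = (real n - 1) * fact (n - 2)"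
    using n fact_reduce[of "n - 1", where ?'a = real] by (simp add: of_nat_diff numeral_2_eq_2)
  have f3: "fact (n - 2) = (real n - 2) * fact (n - 3)"
    using n fact_reduce[of "n - 2", where ?'a = real] by (simp add: of_nat_diff)
  show "fact (n - 1) / fact n = 1 / real n" using n by (simp add: f1)
  \<comment> \<open>The difference of the two sides is \<open>n * (n - 5) + 2\<close>, which is
    where \<open>n \<ge> 5\<close> enters.\<close>
  have "(real n - 1) * (real n - 2) \<ge> 2 * real n"
  proof -
    have "real n * (real n - 5) \<ge> 0" using n by simp
    then show ?thesis by (simp add: algebra_simps)
  qed
  then have "real n * ((real n - 1) * (real n - 2)) \<ge> real n * (2 * real n)"
    by (rule mult_left_mono) simp
  then have ge: "real n * (real n - 1) * (real n - 2) \<ge> 2 * (real n)\<^sup>2"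
    by (simp add: power2_eq_square mult_ac)
  have "fact (n - 3) / fact n = 1 / (real n * (real n - 1) * (real n - 2))"
    unfolding f1 f2 f3 by simp
  also have "\<dots> \<le> 1 / (2 * (real n)\<^sup>2)"
    using ge n by (intro divide_left_mono) auto
  finally show le: "fact (n - 3) / fact n \<le> 1 / 2 * (1 / real n) ^ 2"
    by (simp add: power_divide)
  have "fact (n - 4) \<le> (fact (n - 3) :: real)" by (rule fact_mono) simp
  then have "fact (n - 4) / fact n \<le> (fact (n - 3) / fact n :: real)"
    by (rule divide_right_mono) simp
  then show "fact (n - 4) / fact n \<le> 1 / 2 * (1 / real n) ^ 2" using le by (rule order_trans)
qed

lemma swap_event_union_bound:
  assumes m: "1 \<le> m" "m \<le> k" and n: "n \<ge> 5"
  shows "\<exists>K\<subseteq>{1, 2}.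
    measure_pmf.prob (perm_family n k) (\<Union>P\<in>{P. P \<subseteq> {1..n} \<and> card P \<in> K}. swap_event m P)
      \<ge> (1 / real n) ^ (m - 1) - 1 / 2 * ((1 / real n) ^ 2) ^ (m - 1)"
proof (cases "m = 1")
  case True
  then show ?thesis
    \<comment> \<open>For \<open>m = 1\<close> all powers are 1, and fixed points alone give exactly
      1 - 1/2. Adding the pairs would lower this bound by 1/8.\<close>
    using prob_swap_event_union_ge[of "{1}" m k n] m n by (intro exI[of _ "{1}"]) simp
next
  case False
  define p where "p = m - 1"
  define r :: "nat \<Rightarrow> real" where "r s = fact (n - s) / fact n" for s
  define q where "q = ((1 / real n) ^ 2) ^ p"
  have p: "p \<ge> 1" using False m by (simp add: p_def)
  have "r s ^ p \<le> 1 / 2 * q" if "s \<in> {3, 4}" for s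
  proof -
    have "r s ^ p \<le> (1 / 2 * (1 / real n) ^ 2) ^ p"
      using that fact_quotient_bounds[OF n] by (intro power_mono) (auto simp: r_def)
    also have "\<dots> = (1 / 2) ^ p * q" by (simp only: power_mult_distrib q_def)
    \<comment> \<open>Uses \<open>p \<ge> 1\<close>, that is, \<open>m \<ge> 2\<close>.\<close>
    also have "\<dots> \<le> 1 / 2 * q"
      using power_decreasing[OF p, of "1 / 2 :: real"] by (intro mult_right_mono) (auto simp: q_def)
    finally show ?thesis .
  qed
  from this[of 3] this[of 4] have r34: "r 3 ^ p \<le> 1 / 2 * q" "r 4 ^ p \<le> 1 / 2 * q" by simp_all
  have "q \<ge> 0" by (simp add: q_def)
  have r1: "r 1 = 1 / real n" using fact_quotient_bounds(1)[OF n] by (simp add: r_def)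
  \<comment> \<open>The gain \<open>r 2 ^ p / 2\<close> from pairs cancels the loss from two fixed
    points. The remaining loss is at most \<open>q / 4 + q / 16\<close>, below the allowed
    \<open>q / 2\<close>.\<close>
  have "(\<Sum>s\<in>{1, 2}. r s ^ p / fact s) - 1/2 * (\<Sum>s\<in>{1, 2}. \<Sum>t\<in>{1, 2}. r (s + t) ^ p / (fact s * fact t))
      = r 1 ^ p - r 3 ^ p / 2 - r 4 ^ p / 8"
    by (simp add: numeral_2_eq_2 numeral_3_eq_3 eval_nat_numeral field_simps)
  also have "\<dots> \<ge> (1 / real n) ^ p - 1 / 2 * q"
    unfolding r1 using r34 \<open>q \<ge> 0\<close> by simp
  finally have "(\<Sum>s\<in>{1, 2}. r s ^ p / fact s) -
      1/2 * (\<Sum>s\<in>{1, 2}. \<Sum>t\<in>{1, 2}. r (s + t) ^ p / (fact s * fact t)) \<ge> (1 / real n) ^ p - 1 / 2 * q" .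
  then show ?thesis
    using prob_swap_event_union_ge[of "{1, 2}" m k n, folded r_def p_def] m n
    unfolding p_def[symmetric] q_def[symmetric] by (intro exI[of _ "{1, 2}"]) simp
qed

section \<open>From swap events to the second eigenvalue\<close>

lemma second_eigenvalue_ge_on_swap_event:
  assumes perm: "\<And>l. l \<in> {1..k} \<Longrightarrow> \<pi> l permutes {1..n}"
    and m: "1 \<le> m" "m \<le> k" and n: "n \<ge> 8 * k + 2"
    and P: "P \<subseteq> {1..n}" "card P \<in> {1, 2}" and \<pi>: "\<pi> \<in> swap_event m P"
  shows "eigenvalue_nth 2 (adjacency_matrix n k \<pi>) \<ge> 2 * real m"
proof (rule second_eigenvalue_ge_of_invariant_set[OF perm m P(1) _ _ _ n])
  show "\<pi> l ` P \<subseteq> P" if "l \<in> {1..m}" for l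
    using \<pi> that permutes_in_image[OF pair_swap_permutes[OF P(2)]] by (auto simp: swap_event_def)
qed (use P in auto)

theorem theorem2p10:
  fixes d m :: nat
  assumes "d \<ge> 4" and "even d" and "1 \<le> m" and "m \<le> d div 2"
  shows "\<exists>N. \<forall>n\<ge>N.
    measure_pmf.prob (random_multigraph n d) {G. eigenvalue_nth 2 G \<ge> 2 * real m}
      \<ge> real n powi (1 - int m) - 1/2 * real n powi (2 - 2 * int m)"
proof (intro exI allI impI)
  \<comment> \<open>This threshold covers both \<open>8 * k + 2\<close>, needed for the test
    vectors, and 5, needed for the probability estimate.\<close>
  fix n assume n: "n \<ge> 8 * (d div 2) + 5"
  define k where "k = d div 2"
  have m: "1 \<le> m" "m \<le> k" using assms by (simp_all add: k_def)
  have n': "n \<ge> 8 * k + 2" "n \<ge> 5" using n by (simp_all add: k_def)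
  let ?good = "{\<pi>. eigenvalue_nth 2 (adjacency_matrix n k \<pi>) \<ge> 2 * real m}"
  obtain K where K: "K \<subseteq> {1, 2}"
    and bound: "measure_pmf.prob (perm_family n k)
        (\<Union>P\<in>{P. P \<subseteq> {1..n} \<and> card P \<in> K}. swap_event m P)
      \<ge> (1 / real n) ^ (m - 1) - 1 / 2 * ((1 / real n) ^ 2) ^ (m - 1)"
    (is "measure_pmf.prob _ ?U \<ge> _") using swap_event_union_bound[OF m n'(2)] by blast
  \<comment> \<open>The swap event alone does not make the components permutations, so the inclusion
    is shown on the support only; this does not change the probability.\<close>
  have "?U \<inter> set_pmf (perm_family n k) \<subseteq> ?good"
  proof
    fix \<pi> assume \<pi>: "\<pi> \<in> ?U \<inter> set_pmf (perm_family n k)"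
    have "{\<sigma>. \<sigma> permutes {1..n}} \<noteq> {}" using permutes_id by blast
    then have "\<pi> l permutes {1..n}" if "l \<in> {1..k}" for l
      using \<pi> that
      by (auto simp: perm_family_def set_Pi_pmf PiE_dflt_def set_pmf_of_set finite_permutations)
    then show "\<pi> \<in> ?good"
      using \<pi> K second_eigenvalue_ge_on_swap_event[OF _ m n'(1), of \<pi>] by blast
  qed
  then have "measure_pmf.prob (perm_family n k) (?U \<inter> set_pmf (perm_family n k)) \<le>
      measure_pmf.prob (perm_family n k) ?good"
    by (intro measure_pmf.finite_measure_mono) auto
  then have "measure_pmf.prob (perm_family n k) ?U \<le> measure_pmf.prob (perm_family n k) ?good"
    by (simp only: measure_Int_set_pmf)
  also have "\<dots> = measure_pmf.prob (random_multigraph n d) {G. eigenvalue_nth 2 G \<ge> 2 * real m}"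
    unfolding random_multigraph_def k_def[symmetric] perm_family_def[symmetric]
    by (simp add: vimage_def)
  finally have le: "measure_pmf.prob (perm_family n k) ?U \<le>
    measure_pmf.prob (random_multigraph n d) {G. eigenvalue_nth 2 G \<ge> 2 * real m}" .
  \<comment> \<open>The integer exponents are nonpositive for \<open>m \<ge> 1\<close>, so they
    become natural powers of \<open>1 / real n\<close>.\<close>
  have "1 - int m = - int (m - 1)" "2 - 2 * int m = - int (2 * (m - 1))"
    using m(1) by (simp_all add: of_nat_diff)
  then have "real n powi (1 - int m) = (1 / real n) ^ (m - 1)"
    "real n powi (2 - 2 * int m) = ((1 / real n) ^ 2) ^ (m - 1)"
    by (simp_all only: power_int_minus power_int_of_nat power_mult[symmetric] power_one_over inverse_eq_divide)
  then show "measure_pmf.prob (random_multigraph n d) {G. eigenvalue_nth 2 G \<ge> 2 * real m}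
      \<ge> real n powi (1 - int m) - 1/2 * real n powi (2 - 2 * int m)"
    using bound le by simp
qed

end
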